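(* For any supplier price $q\ge0$ there exists $\underline\delta>0$ such that for every $\delta$ with $0<\delta\le\underline\delta$ the manufacturer game $\mathbb G(q,\delta)$ has no operating Nash equilibrium, i.e. no pure strategy Nash equilibrium $(p_i,p_j)$ with $p_i\neq n_o$ and $p_j\ne n_o$.
   Context: Parameters: $\bar d>0$, $\alpha>0$, $0<\varepsilon<1$, $C_M\ge0$, $O_M>0$, $C_S\ge 0$ are real constants, with the standing assumption $\bar d>\alpha(C_S+C_M)+2\sqrt{\alpha O_M}$. For a supplier price $q\ge0$ put $C_{M_q}:=C_M+q$. For $x\in\mathbb R$, $x^+:=\max\{x,0\}$. Game $\mathbb G(q,\delta)$: two players (manufacturers) $i,j$, each with strategy set $\mathbb P_\delta\cup\{n_o\}$, where $\mathbb P_\delta=\{0,\delta,2\delta,\dots\}$ and $n_o$ means "do not operate". Define - $W_1(p,p')=(\bar d-\alpha(1-\varepsilon)p+\varepsilon\alpha p')^+(p-C_{M_q})-O_M$, - $W_2(p)=(\bar d-\alpha p)^+(p-C_{M_q})-O_M$, - $W_3(p)=(\bar d-\alpha(1-\varepsilon)p)^+(p-C_{M_q})-O_M$, - $W_4(p)=(\bar d(1+\varepsilon)-\alpha(1-\varepsilon)p)^+(p-C_{M_q})-O_M$. The utility of player $i$ is $U_i(p_i,p_j)=0$ if $p_i=n_o$; and, for $p_i\in\mathbb P_\delta$, it equals $W_4(p_i)$ if $p_j=n_o$, $W_1(p_i,p_j)$ if $p_i<p_j$, $W_2(p_i)$ if $p_i>p_j$, and $W_3(p_i)$ if $p_i=p_j$.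 The utility of player $j$ is defined symmetrically, with the roles of $i$ and $j$ exchanged. A pure strategy Nash equilibrium is a pair of strategies, each of which maximizes its player's utility over $\mathbb P_\delta\cup\{n_o\}$ given the other's strategy. *)

theory Defs
  imports Complex_Main
begin

datatype strategy = Not_Operate | Price real

definition price_grid :: "real \<Rightarrow> real set" where
  "price_grid \<delta> = {real k * \<delta> | k. True}"

definition strategies :: "real \<Rightarrow> strategy set" where
  "strategies \<delta> = insert Not_Operate (Price ` price_grid \<delta>)"

(* d is the demand potential, \<alpha> the price
   sensitivity, \<epsilon> the substitutability, CM the manufacturing cost (excluding the supplier price),
   OM the operating cost, and q the supplier price. *)

definition W1 :: "real \<Rightarrow> real \<Rightarrow> real \<Rightarrow> real \<Rightarrow> real \<Rightarrow> real \<Rightarrow> real \<Rightarrow> real \<Rightarrow> real" where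
  "W1 d \<alpha> \<epsilon> CM OM q p p' =
     max (d - \<alpha> * (1 - \<epsilon>) * p + \<epsilon> * \<alpha> * p') 0 * (p - (CM + q)) - OM"

definition W2 :: "real \<Rightarrow> real \<Rightarrow> real \<Rightarrow> real \<Rightarrow> real \<Rightarrow> real \<Rightarrow> real" where
  "W2 d \<alpha> CM OM q p = max (d - \<alpha> * p) 0 * (p - (CM + q)) - OM"

definition W3 :: "real \<Rightarrow> real \<Rightarrow> real \<Rightarrow> real \<Rightarrow> real \<Rightarrow> real \<Rightarrow> real \<Rightarrow> real" where
  "W3 d \<alpha> \<epsilon> CM OM q p = max (d - \<alpha> * (1 - \<epsilon>) * p) 0 * (p - (CM + q)) - OM"

definition W4 :: "real \<Rightarrow> real \<Rightarrow> real \<Rightarrow> real \<Rightarrow> real \<Rightarrow> real \<Rightarrow> real \<Rightarrow> real" where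
  "W4 d \<alpha> \<epsilon> CM OM q p =
     max (d * (1 + \<epsilon>) - \<alpha> * (1 - \<epsilon>) * p) 0 * (p - (CM + q)) - OM"

(* The first strategy is the player's own, the second the opponent's. *)
fun utility ::
  "real \<Rightarrow> real \<Rightarrow> real \<Rightarrow> real \<Rightarrow> real \<Rightarrow> real \<Rightarrow> strategy \<Rightarrow> strategy \<Rightarrow> real" where
  "utility d \<alpha> \<epsilon> CM OM q Not_Operate s = 0"
| "utility d \<alpha> \<epsilon> CM OM q (Price p) Not_Operate = W4 d \<alpha> \<epsilon> CM OM q p"
| "utility d \<alpha> \<epsilon> CM OM q (Price p) (Price p') =
     (if p < p' then W1 d \<alpha> \<epsilon> CM OM q p p'
      else if p > p' then W2 d \<alpha> CM OM q p
      else W3 d \<alpha> \<epsilon> CM OM q p)"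

(* The game is symmetric, so u x y is the payoff of either player from playing x against y;
   the second player's payoff at the profile (x, y) is u y x. *)
definition pure_nash :: "'s set \<Rightarrow> ('s \<Rightarrow> 's \<Rightarrow> real) \<Rightarrow> 's \<Rightarrow> 's \<Rightarrow> bool" where
  "pure_nash S u x y \<longleftrightarrow>
     x \<in> S \<and> y \<in> S \<and> (\<forall>x'\<in>S. u x' y \<le> u x y) \<and> (\<forall>y'\<in>S. u y' x \<le> u y x)"

end

theory Submission
  imports Defs
begin

text \<open>
  Operating at a loss is never a best response, so the undercut price exceeds the unit cost by a
  margin that does not depend on \<open>\<delta>\<close>. With \<open>\<delta>\<close> small against this margin, two manufacturers at the
  same price, or at prices one step apart, cannot be in equilibrium: moving one step down
  to undercut or match the rival gains a fixed amount of demand at a cost of order \<open>\<delta>\<close>. If the prices are at least two steps apart, the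
  player with the higher price does not want to step down and the player with the lower price does
  not want to step up; the first-order conditions for these two moves contradict each other, as
  the low-price player faces the larger and less elastic demand.
\<close>

lemma price_in_strategies_iff: "Price p \<in> strategies \<delta> \<longleftrightarrow> (\<exists>k::nat. p = real k * \<delta>)"
  by (auto simp: strategies_def price_grid_def)

lemma price_step_up: "Price p \<in> strategies \<delta> \<Longrightarrow> Price (p + \<delta>) \<in> strategies \<delta>"
  unfolding price_in_strategies_iff
  by (metis add.commute distrib_left mult.commute mult.right_neutral of_nat_Suc)

lemma price_step_down:
  assumes "Price p \<in> strategies \<delta>" and "p > 0"
  shows "Price (p - \<delta>) \<in> strategies \<delta>"
proof -
  obtain k :: nat where k: "p = real k * \<delta>"
    using assms(1) by (auto simp: price_in_strategies_iff)
  with assms(2) obtain l where "k = Suc l"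
    by (cases k) auto
  with k have "p - \<delta> = real l * \<delta>"
    by (simp add: algebra_simps)
  then show ?thesis
    by (auto simp: price_in_strategies_iff)
qed

lemma price_nonneg: "Price p \<in> strategies \<delta> \<Longrightarrow> \<delta> > 0 \<Longrightarrow> p \<ge> 0"
  by (auto simp: price_in_strategies_iff)

lemma pure_nash_sym: "pure_nash S u x y \<Longrightarrow> pure_nash S u y x"
  by (auto simp: pure_nash_def)

lemma pure_nash_utility_nonneg:
  assumes "pure_nash (strategies \<delta>) (utility d \<alpha> \<epsilon> CM OM q) x y"
  shows "utility d \<alpha> \<epsilon> CM OM q x y \<ge> 0"
proof -
  have "Not_Operate \<in> strategies \<delta>"
    by (simp add: strategies_def)
  then have "utility d \<alpha> \<epsilon> CM OM q Not_Operate y \<le> utility d \<alpha> \<epsilon> CM OM q x y"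
    using assms unfolding pure_nash_def by blast
  then show ?thesis by simp
qed

text \<open>Revenue of at least \<open>OM > 0\<close> forces both factors to be positive. Since
  demand never exceeds \<open>d\<close>, the margin must be at least \<open>OM / d\<close>, whatever
  the price and the grid.\<close>

lemma profitable_margin:
  fixes D d m OM :: real
  assumes "max D 0 * m \<ge> OM" and "OM > 0" and "D \<le> d"
  shows "D > 0" and "m \<ge> OM / d"
proof -
  show D: "D > 0"
    using assms(1,2) by (cases "D > 0") (auto simp: max_def)
  then have "D * m > 0"
    using assms(1,2) by (simp add: max_def)
  then have "m > 0"
    using D by (simp add: zero_less_mult_iff)
  then have "D * m \<le> d * m"
    using assms(3) by (simp add: mult_right_mono)
  then have "OM \<le> d * m"
    using assms(1) D by (simp add: max_def)
  then show "m \<ge> OM / d"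
    using D assms(3) by (simp add: field_simps)
qed

text \<open>The deviation is to undercut by one step. It adds demand of at least
  \<open>\<epsilon> * \<alpha> * p\<close>, sold at a margin still at least \<open>m / 2\<close>,
  and gives up \<delta> on each unit of the old demand, at most \<open>\<delta> * d\<close> in all.
  The last assumption makes the gain larger.\<close>

lemma no_tied_nash:
  fixes d \<alpha> \<epsilon> CM OM q \<delta> :: real
  defines "m \<equiv> OM / d"
  assumes "d > 0" "\<alpha> > 0" "0 < \<epsilon>" "\<epsilon> < 1" "CM + q \<ge> 0" "OM > 0"
    and "\<delta> > 0" "\<delta> \<le> m / 2" "\<delta> * d < \<epsilon> * \<alpha> * (m / 2) * (m / 2)"
  shows "\<not> pure_nash (strategies \<delta>) (utility d \<alpha> \<epsilon> CM OM q) (Price p) (Price p)"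
proof
  assume nash: "pure_nash (strategies \<delta>) (utility d \<alpha> \<epsilon> CM OM q) (Price p) (Price p)"
  define c where "c = CM + q"
  define D where "D = d - \<alpha> * (1 - \<epsilon>) * p"
  have p: "Price p \<in> strategies \<delta>"
    using nash by (simp add: pure_nash_def)
  have "m > 0"
    using assms by simp
  have "max D 0 * (p - c) \<ge> OM"
    using pure_nash_utility_nonneg[OF nash] by (simp add: W3_def c_def D_def)
  moreover have "D \<le> d"
    using price_nonneg[OF p \<open>\<delta> > 0\<close>] assms by (simp add: D_def)
  ultimately have D: "D > 0" and margin: "p - c \<ge> m"
    using profitable_margin \<open>OM > 0\<close> unfolding m_def by blast+
  \<comment> \<open>As the unit cost is nonnegative, the margin also bounds the price itself, hence
    the extra demand \<open>\<epsilon> * \<alpha> * p\<close>.\<close>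
  have "p \<ge> m"
    using margin assms unfolding c_def by linarith
  define E where "E = d - \<alpha> * (1 - \<epsilon>) * (p - \<delta>) + \<epsilon> * \<alpha> * p"
  have E: "E = D + \<alpha> * (1 - \<epsilon>) * \<delta> + \<epsilon> * \<alpha> * p"
    by (simp add: E_def D_def algebra_simps)
  have "Price (p - \<delta>) \<in> strategies \<delta>"
    using price_step_down[OF p] \<open>p \<ge> m\<close> \<open>m > 0\<close> by simp
  then have "utility d \<alpha> \<epsilon> CM OM q (Price (p - \<delta>)) (Price p)
      \<le> utility d \<alpha> \<epsilon> CM OM q (Price p) (Price p)"
    using nash unfolding pure_nash_def by blast
  then have "max E 0 * (p - \<delta> - c) \<le> D * (p - c)"
    using \<open>\<delta> > 0\<close> D by (simp add: W1_def W3_def c_def D_def E_def)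
  moreover have "E * (p - \<delta> - c) \<le> max E 0 * (p - \<delta> - c)"
    using margin assms(9) \<open>m > 0\<close> by (intro mult_right_mono) auto
  ultimately have "E * (p - \<delta> - c) \<le> D * (p - c)"
    by linarith
  \<comment> \<open>Cancelling \<open>D * (p - \<delta> - c)\<close> leaves the profit on the
    additional demand against the margin lost on the old demand.\<close>
  then have "\<alpha> * (1 - \<epsilon>) * \<delta> * (p - \<delta> - c) + \<epsilon> * \<alpha> * p * (p - \<delta> - c) \<le> \<delta> * D"
    by (simp add: E algebra_simps)
  moreover have "\<alpha> * (1 - \<epsilon>) * \<delta> * (p - \<delta> - c) \<ge> 0"
    using margin assms \<open>m > 0\<close> by (intro mult_nonneg_nonneg) auto
  moreover have "\<epsilon> * \<alpha> * p * (p - \<delta> - c) \<ge> \<epsilon> * \<alpha> * (m / 2) * (m / 2)"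
    using margin assms \<open>m > 0\<close> \<open>p \<ge> m\<close> by (intro mult_mono mult_nonneg_nonneg) auto
  moreover have "\<delta> * D \<le> \<delta> * d"
    using \<open>D \<le> d\<close> \<open>\<delta> > 0\<close> by simp
  ultimately show False
    using assms(10) by linarith
qed

text \<open>The grid gap decides which deviation is used. At one step the dearer player matches the
  rival; at two or more, both players move one step inwards without reversing the order of the
  prices.\<close>

lemma no_untied_nash:
  fixes d \<alpha> \<epsilon> CM OM q \<delta> :: real
  defines "m \<equiv> OM / d"
  assumes "d > 0" "\<alpha> > 0" "0 < \<epsilon>" "\<epsilon> < 1" "CM + q \<ge> 0" "OM > 0"
    and "\<delta> > 0" "\<delta> \<le> m / 2" "\<delta> * d < \<epsilon> * \<alpha> * (m / 2) * (m / 2)"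
    and "p < p'"
  shows "\<not> pure_nash (strategies \<delta>) (utility d \<alpha> \<epsilon> CM OM q) (Price p) (Price p')"
proof
  assume nash: "pure_nash (strategies \<delta>) (utility d \<alpha> \<epsilon> CM OM q) (Price p) (Price p')"
  define c where "c = CM + q"
  define D where "D = d - \<alpha> * p'"
  have p: "Price p \<in> strategies \<delta>" and p': "Price p' \<in> strategies \<delta>"
    using nash by (auto simp: pure_nash_def)
  have best: "utility d \<alpha> \<epsilon> CM OM q (Price x) (Price p')
      \<le> utility d \<alpha> \<epsilon> CM OM q (Price p) (Price p')"
    and best': "utility d \<alpha> \<epsilon> CM OM q (Price x) (Price p)
      \<le> utility d \<alpha> \<epsilon> CM OM q (Price p') (Price p)"
    if "Price x \<in> strategies \<delta>" for x
    using nash that unfolding pure_nash_def by blast+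
  have "p \<ge> 0"
    using price_nonneg[OF p \<open>\<delta> > 0\<close>] .
  have "m > 0"
    using assms by simp
  \<comment> \<open>Symmetry puts the dearer player first, so the participation bound applies to
    \<open>p'\<close>.\<close>
  have "max D 0 * (p' - c) \<ge> OM"
    using pure_nash_utility_nonneg[OF pure_nash_sym[OF nash]] \<open>p < p'\<close>
    by (simp add: W2_def c_def D_def)
  moreover have "D \<le> d"
    using \<open>p \<ge> 0\<close> \<open>p < p'\<close> assms by (simp add: D_def)
  ultimately have D: "D > 0" and margin: "p' - c \<ge> m"
    using profitable_margin \<open>OM > 0\<close> unfolding m_def by blast+
  obtain k l :: nat where kl: "p = real k * \<delta>" "p' = real l * \<delta>"
    using p p' by (auto simp: price_in_strategies_iff)
  then have "k < l"
    using \<open>p < p'\<close> \<open>\<delta> > 0\<close> by simp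
  then consider "l = Suc k" | "l \<ge> k + 2"
    by linarith
  then show False
  proof cases
    case 1
    then have step: "p' = p + \<delta>"
      by (simp add: kl algebra_simps)
    \<comment> \<open>\<open>E\<close> is the dearer player's demand after matching; it exceeds
      \<open>D\<close> by at least \<open>\<epsilon> * \<alpha> * p\<close>, as in the tied
      case.\<close>
    define E where "E = d - \<alpha> * (1 - \<epsilon>) * p"
    have E: "E = D + \<alpha> * \<delta> + \<epsilon> * \<alpha> * p"
      by (simp add: E_def D_def step algebra_simps)
    have low_margin: "p - c \<ge> m / 2"
      using margin step assms(9) by linarith
    then have "p \<ge> m / 2"
      using assms(6) unfolding c_def by linarith
    have "max E 0 * (p - c) \<le> D * (p' - c)"
      using best'[OF p] \<open>p < p'\<close> D by (simp add: W2_def W3_def c_def D_def E_def)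
    moreover have "E * (p - c) \<le> max E 0 * (p - c)"
      using low_margin \<open>m > 0\<close> by (intro mult_right_mono) auto
    ultimately have "E * (p - c) \<le> D * (p' - c)"
      by linarith
    then have "\<alpha> * \<delta> * (p - c) + \<epsilon> * \<alpha> * p * (p - c) \<le> \<delta> * D"
      by (simp add: E step algebra_simps)
    moreover have "\<alpha> * \<delta> * (p - c) \<ge> 0"
      using low_margin assms \<open>m > 0\<close> by (intro mult_nonneg_nonneg) auto
    moreover have "\<epsilon> * \<alpha> * p * (p - c) \<ge> \<epsilon> * \<alpha> * (m / 2) * (m / 2)"
      using low_margin assms \<open>m > 0\<close> \<open>p \<ge> m / 2\<close> by (intro mult_mono mult_nonneg_nonneg) auto
    moreover have "\<delta> * D \<le> \<delta> * d"
      using \<open>D \<le> d\<close> \<open>\<delta> > 0\<close> by simp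
    ultimately show False
      using assms(10) by linarith
  next
    case 2
    then have "real (k + 2) * \<delta> \<le> real l * \<delta>"
      using \<open>\<delta> > 0\<close> by (intro mult_right_mono) auto
    \<comment> \<open>Thus \<open>p < p' - \<delta>\<close> and \<open>p + \<delta> < p'\<close>:
      after either single step the payoffs are still given by \<open>W2\<close> and
      \<open>W1\<close>.\<close>
    then have gap: "p + 2 * \<delta> \<le> p'"
      by (simp add: kl algebra_simps)
    have "\<alpha> * \<delta> > 0"
      using assms by simp
    have D_down: "d - \<alpha> * (p' - \<delta>) = D + \<alpha> * \<delta>"
      by (simp add: D_def algebra_simps)
    have "Price (p' - \<delta>) \<in> strategies \<delta>"
      using price_step_down[OF p'] \<open>p \<ge> 0\<close> \<open>p < p'\<close> by simp
    from best'[OF this] have "max (D + \<alpha> * \<delta>) 0 * (p' - \<delta> - c) \<le> max D 0 * (p' - c)"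
      using gap \<open>\<delta> > 0\<close> \<open>p < p'\<close> D_down
      by (simp add: W2_def c_def flip: D_def)
    then have "(D + \<alpha> * \<delta>) * (p' - \<delta> - c) \<le> D * (p' - c)"
      using D \<open>\<alpha> * \<delta> > 0\<close> by (simp add: max_def)
    then have "\<delta> * (\<alpha> * (p' - \<delta> - c)) \<le> \<delta> * D"
      by (simp add: algebra_simps)
    \<comment> \<open>A discrete first-order condition: the margin earned on the demand gained by a
      step down does not exceed the loss on the present demand \<open>D\<close>.\<close>
    then have high_foc: "\<alpha> * (p' - \<delta> - c) \<le> D"
      using \<open>\<delta> > 0\<close> by simp
    define E where "E = d - \<alpha> * (1 - \<epsilon>) * p + \<epsilon> * \<alpha> * p'"
    \<comment> \<open>\<open>E\<close> and \<open>F\<close> are the cheaper player's demands before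
      and after a step up.\<close>
    define F where "F = d - \<alpha> * (1 - \<epsilon>) * (p + \<delta>) + \<epsilon> * \<alpha> * p'"
    have F: "F = E - \<alpha> * (1 - \<epsilon>) * \<delta>"
      by (simp add: E_def F_def algebra_simps)
    have "F = D + \<alpha> * (p' - (p + \<delta>)) + \<epsilon> * \<alpha> * (p + \<delta> + p')"
      by (simp add: F_def D_def algebra_simps)
    moreover have "\<alpha> * (p' - (p + \<delta>)) \<ge> \<alpha> * \<delta>"
      using gap assms by (intro mult_left_mono) auto
    moreover note \<open>\<alpha> * \<delta> > 0\<close>
    moreover have "\<epsilon> * \<alpha> * (p + \<delta> + p') > 0"
      using assms \<open>p \<ge> 0\<close> by simp
    ultimately have F_large: "F > D" and "F > 0"
      using D by linarith+
    have "\<alpha> * (1 - \<epsilon>) * \<delta> > 0"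
      using assms by simp
    then have "E > 0"
      using F \<open>F > 0\<close> by linarith
    have "max F 0 * (p + \<delta> - c) \<le> max E 0 * (p - c)"
      using best[OF price_step_up[OF p]] gap \<open>\<delta> > 0\<close> \<open>p < p'\<close>
      by (simp add: W1_def c_def flip: E_def F_def)
    then have "F * (p + \<delta> - c) \<le> E * (p - c)"
      using \<open>E > 0\<close> \<open>F > 0\<close> by (simp add: max_def)
    then have "\<delta> * F \<le> \<delta> * (\<alpha> * (1 - \<epsilon>) * (p - c))"
      by (simp add: F algebra_simps)
    then have low_foc: "F \<le> \<alpha> * (1 - \<epsilon>) * (p - c)"
      using \<open>\<delta> > 0\<close> by simp
    then have "\<alpha> * (1 - \<epsilon>) * (p - c) > 0"
      using \<open>F > 0\<close> by linarith
    then have "p - c > 0"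
      using assms by (simp add: zero_less_mult_iff mult_less_0_iff)
    \<comment> \<open>A positive margin lets the factor \<open>1 - \<epsilon>\<close> be dropped.
      The two conditions then chain to \<open>F \<le> D\<close>, against
      \<open>F_large\<close>.\<close>
    then have "\<alpha> * (1 - \<epsilon>) * (p - c) \<le> \<alpha> * (p - c)"
      using assms by (intro mult_right_mono) auto
    also have "\<dots> \<le> \<alpha> * (p' - \<delta> - c)"
      using gap assms by (intro mult_left_mono) auto
    finally show False
      using high_foc low_foc F_large by linarith
  qed
qed

theorem theorem3:
  fixes d \<alpha> \<epsilon> CM OM CS q :: real
  assumes "d > 0" and "\<alpha> > 0" and "0 < \<epsilon>" and "\<epsilon> < 1"
    and "CM \<ge> 0" and "OM > 0" and "CS \<ge> 0"
    and "d > \<alpha> * (CS + CM) + 2 * sqrt (\<alpha> * OM)"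
    and "q \<ge> 0"
  shows "\<exists>\<delta>\<^sub>0>0. \<forall>\<delta>. 0 < \<delta> \<and> \<delta> \<le> \<delta>\<^sub>0 \<longrightarrow>
    \<not> (\<exists>s\<^sub>i s\<^sub>j. pure_nash (strategies \<delta>) (utility d \<alpha> \<epsilon> CM OM q) s\<^sub>i s\<^sub>j \<and>
         s\<^sub>i \<noteq> Not_Operate \<and> s\<^sub>j \<noteq> Not_Operate)"
proof -
  define m where "m = OM / d"
  define b where "b = \<epsilon> * \<alpha> * (m / 2) * (m / 2)"
  \<comment> \<open>The first bound keeps half the margin after one step. The second gives
    \<open>\<delta> * d \<le> b / 2\<close>, where the factor 2 secures strict inequality with
    \<open>b\<close>.\<close>
  define \<delta>\<^sub>0 where "\<delta>\<^sub>0 = min (m / 2) (b / (2 * d))"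
  have "m > 0" "b > 0"
    using assms by (simp_all add: m_def b_def)
  show ?thesis
  proof (intro exI[of _ \<delta>\<^sub>0] conjI allI impI notI)
    show "\<delta>\<^sub>0 > 0"
      using \<open>m > 0\<close> \<open>b > 0\<close> assms by (simp add: \<delta>\<^sub>0_def)
  next
    fix \<delta>
    assume \<delta>: "0 < \<delta> \<and> \<delta> \<le> \<delta>\<^sub>0"
    then have small: "\<delta> \<le> m / 2" and "\<delta> \<le> b / (2 * d)"
      by (auto simp: \<delta>\<^sub>0_def)
    then have "\<delta> * d \<le> b / 2"
      using assms by (simp add: field_simps)
    then have small': "\<delta> * d < \<epsilon> * \<alpha> * (m / 2) * (m / 2)"
      using \<open>b > 0\<close> unfolding b_def by linarith
    have "CM + q \<ge> 0"
      using assms by simp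
    note bounds = \<open>d > 0\<close> \<open>\<alpha> > 0\<close> \<open>0 < \<epsilon>\<close> \<open>\<epsilon> < 1\<close> this \<open>OM > 0\<close>
      conjunct1[OF \<delta>] small[unfolded m_def] small'[unfolded m_def]
    assume "\<exists>s\<^sub>i s\<^sub>j. pure_nash (strategies \<delta>) (utility d \<alpha> \<epsilon> CM OM q) s\<^sub>i s\<^sub>j \<and>
      s\<^sub>i \<noteq> Not_Operate \<and> s\<^sub>j \<noteq> Not_Operate"
    then obtain p p' where
      nash: "pure_nash (strategies \<delta>) (utility d \<alpha> \<epsilon> CM OM q) (Price p) (Price p')"
      by (metis strategy.exhaust)
    consider "p = p'" | "p < p'" | "p' < p"
      by linarith
    then show False
      using nash pure_nash_sym[OF nash] no_tied_nash[OF bounds] no_untied_nash[OF bounds]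
      by cases blast+
  qed
qed

end
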